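(* Let $u$ be a uniformly recurrent infinite word over a finite alphabet. Then $u$ is Sturmian if and only if there exist infinitely many factors $w$ of $u$ such that $$R(|w|) = |w|\,\mathrm{ind}(w)+1,$$ where $R$ is the recurrence function of $u$ and $\mathrm{ind}(w)$ is the index of $w$ in $u$.
   Context: An infinite word is $u=u_0u_1u_2\cdots$. A factor of $u$ is a finite word $v$ with $u=pvu'$ for some finite $p$ and infinite $u'$; $\mathcal L(u)$ denotes the set of factors, $\mathcal L_n(u)$ those of length $n$, and $\mathcal C(n)=\#\mathcal L_n(u)$ is the complexity. $u$ is Sturmian if $\mathcal C(n)=n+1$ for all $n$ (equivalently, $u$ is aperiodic with complexity $n+1$). For a factor $w$, a return word of $w$ is a factor $v$ such that $vw\in\mathcal L(u)$, $w$ is a prefix of $vw$, and $w$ occurs in $vw$ exactly twice ($vw$ is a complete return word). $u$ is uniformly recurrent if every factor has finitely many return words. The recurrence function is $R(n)=-1+\max\{|vw| : w\in\mathcal L_n(u),\ v \text{ a return word of } w\}$. A word $v$ is a power of $w$, written $v=w^r$ with $r=|v|/|w|$, if $|v|\ge|w|$ and $v$ is a prefix of the infinite periodic word $www\cdots$. The index of a factor $w$ in $u$ is $\mathrm{ind}(w)=\sup\{r\in\mathbb Q : w^r\in\mathcal L(u)\}$.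
   Formalization: The word u is additionally assumed aperiodic (not eventually periodic), since the claim fails for the periodic word ababab...; "uniformly recurrent" is taken to include that every factor occurs infinitely often. *)

theory Defs
  imports Complex_Main "HOL-Library.Omega_Words_Fun" "HOL-Library.Sublist"
    "HOL-Library.Extended_Real"
begin

definition factors :: "'a word \<Rightarrow> 'a list set" where
  "factors u = {v. \<exists>p u'. u = p \<frown> v \<frown> u'}"

definition factors_of_length :: "'a word \<Rightarrow> nat \<Rightarrow> 'a list set" where
  "factors_of_length u n = {v \<in> factors u. length v = n}"

definition complexity :: "'a word \<Rightarrow> nat \<Rightarrow> nat" where
  "complexity u n = card (factors_of_length u n)"

definition sturmian :: "'a word \<Rightarrow> bool" where
  "sturmian u \<longleftrightarrow> (\<forall>n. complexity u n = n + 1)"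

definition eventually_periodic :: "'a word \<Rightarrow> bool" where
  "eventually_periodic u \<longleftrightarrow> (\<exists>p v. v \<noteq> [] \<and> u = p \<frown> v\<^sup>\<omega>)"

definition aperiodic :: "'a word \<Rightarrow> bool" where
  "aperiodic u \<longleftrightarrow> \<not> eventually_periodic u"

text \<open>An occurrence of a word in a finite word is given by the part before it and the part
  after it.\<close>

definition occurrences :: "'a list \<Rightarrow> 'a list \<Rightarrow> ('a list \<times> 'a list) set" where
  "occurrences w x = {(p, s). x = p @ w @ s}"

definition return_words :: "'a word \<Rightarrow> 'a list \<Rightarrow> 'a list set" where
  "return_words u w =
     {v \<in> factors u. v @ w \<in> factors u \<and> Sublist.prefix w (v @ w) \<and> card (occurrences w (v @ w)) = 2}"

definition recurrent :: "'a word \<Rightarrow> bool" where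
  "recurrent u \<longleftrightarrow> (\<forall>w\<in>factors u. infinite {p. \<exists>u'. u = p \<frown> w \<frown> u'})"

text \<open>Recurrence is part of the notion. Finiteness of the sets of return words alone does not
  imply it, since a factor that occurs only once has no return word at all.\<close>

definition uniformly_recurrent :: "'a word \<Rightarrow> bool" where
  "uniformly_recurrent u \<longleftrightarrow> recurrent u \<and> (\<forall>w\<in>factors u. finite (return_words u w))"

text \<open>The maximum is meaningful because the set is finite and nonempty when \<open>u\<close> is a uniformly
  recurrent word over a finite alphabet.\<close>

definition recurrence_function :: "'a word \<Rightarrow> nat \<Rightarrow> int" where
  "recurrence_function u n =
     - 1 + int (Max {length (v @ w) |v w. w \<in> factors_of_length u n \<and> v \<in> return_words u w})"

definition is_power :: "'a list \<Rightarrow> 'a list \<Rightarrow> rat \<Rightarrow> bool" where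
  "is_power v w r \<longleftrightarrow> w \<noteq> [] \<and> length v \<ge> length w \<and> (\<exists>x. w\<^sup>\<omega> = v \<frown> x)
     \<and> r = of_nat (length v) / of_nat (length w)"

text \<open>The index is infinite if arbitrarily large powers of \<open>w\<close> occur in \<open>u\<close>.\<close>

definition ind :: "'a word \<Rightarrow> 'a list \<Rightarrow> ereal" where
  "ind u w = Sup {ereal (of_rat r) |r. \<exists>v\<in>factors u. is_power v w r}"

end

theory Submission
  imports Defs
begin

text \<open>\<open>R n\<close> is the least \<open>N\<close> such that every factor of length \<open>N\<close> contains all factors of length \<open>n\<close>.
  A power of a word of length \<open>n\<close> contains at most \<open>n\<close> factors of length \<open>n\<close>, and lengthening it by
  one letter adds at most one. So if \<open>R n - 1\<close> is the length of such a power, then \<open>u\<close> has at most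
  \<open>n + 1\<close> factors of length \<open>n\<close>; for an aperiodic word, this for infinitely many \<open>n\<close> means Sturmian.

  Conversely, let \<open>u\<close> be Sturmian. Powers of words of length \<open>n\<close> are then shorter than \<open>R n\<close>. Since
  \<open>R n \<ge> 2 n\<close>, there are infinitely many \<open>m\<close> with \<open>R (m + 1) \<ge> R m + 2\<close>. For such an \<open>m\<close> take a
  factor \<open>z\<close> of length \<open>R (m + 1) - 1\<close> that avoids a factor \<open>x\<close> of length \<open>m + 1\<close>. Both \<open>z\<close> without
  its first letter and \<open>z\<close> without its last letter contain all \<open>m + 1\<close> factors of length \<open>m\<close>. As
  there are only \<open>m + 1\<close> factors of length \<open>m + 1\<close> other than \<open>x\<close>, each factor of length \<open>m\<close> has a
  unique continuation inside \<open>z\<close>. Hence \<open>z\<close> runs through a single cycle of length \<open>m + 1\<close> in the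
  Rauzy graph, that is, \<open>z\<close> has period \<open>m + 1\<close>.\<close>

subsection \<open>Factors and their positions\<close>

text \<open>Fixing the start position turns questions about overlapping occurrences into index
  arithmetic.\<close>

definition window :: "'a word \<Rightarrow> nat \<Rightarrow> nat \<Rightarrow> 'a list" where
  "window u i n = map (\<lambda>k. u (i + k)) [0..<n]"

lemma length_window [simp]: "length (window u i n) = n"
  by (simp add: window_def)

lemma nth_window [simp]: "k < n \<Longrightarrow> window u i n ! k = u (i + k)"
  by (simp add: window_def)

lemma window_eq_Nil_iff [simp]: "window u i n = [] \<longleftrightarrow> n = 0"
  by (simp add: window_def)

lemma take_window: "k \<le> n \<Longrightarrow> take k (window u i n) = window u i k"
  by (rule nth_equalityI) auto

lemma drop_window: "drop k (window u i n) = window u (i + k) (n - k)"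
  by (rule nth_equalityI) (auto simp: add.assoc)

lemma window_add: "window u i (m + n) = window u i m @ window u (i + m) n"
  by (rule nth_equalityI) (auto simp: nth_append)

lemma butlast_window: "butlast (window u i n) = window u i (n - 1)"
  by (simp add: butlast_conv_take take_window)

lemma window_in_factors [simp]: "window u i n \<in> factors u"
proof -
  have "u = window u 0 i \<frown> window u i n \<frown> (\<lambda>k. u (i + n + k))"
    by (rule ext) (auto simp: conc_def nth_append)
  then show ?thesis
    unfolding factors_def by blast
qed

lemma factors_of_length_iff: "v \<in> factors_of_length u n \<longleftrightarrow> (\<exists>i. v = window u i n)"
proof
  assume "v \<in> factors_of_length u n"
  then obtain p u' where u: "u = p \<frown> v \<frown> u'" and n: "length v = n"
    by (auto simp: factors_of_length_def factors_def)
  have "v = window u (length p) n"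
    by (rule nth_equalityI) (auto simp: u n nth_append)
  then show "\<exists>i. v = window u i n" ..
qed (auto simp: factors_of_length_def)

lemma factors_iff: "v \<in> factors u \<longleftrightarrow> (\<exists>i. v = window u i (length v))"
  using factors_of_length_iff[of v u "length v"] by (simp add: factors_of_length_def)

lemma window_in_factors_of_length [simp]: "window u i n \<in> factors_of_length u n"
  by (auto simp: factors_of_length_iff)

lemma finite_factors_of_length:
  assumes "finite (range u)"
  shows "finite (factors_of_length u n)"
proof (rule finite_subset)
  show "factors_of_length u n \<subseteq> {v. set v \<subseteq> range u \<and> length v = n}"
    by (auto simp: factors_of_length_iff window_def)
  show "finite {v. set v \<subseteq> range u \<and> length v = n}"
    using assms by (rule finite_lists_length_eq)
qed

lemma window_eq_append3D:
  assumes "window u i N = ps @ x @ ss"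
  shows "x = window u (i + length ps) (length x)" "N = length ps + length x + length ss"
proof -
  show N: "N = length ps + length x + length ss"
    using arg_cong[OF assms, of length] by simp
  have "x = take (length x) (drop (length ps) (window u i N))"
    by (simp add: assms)
  also have "\<dots> = window u (i + length ps) (length x)"
    by (simp add: drop_window take_window N)
  finally show "x = window u (i + length ps) (length x)" .
qed

lemma sublist_window_iff:
  assumes "length x = n"
  shows "sublist x (window u i N) \<longleftrightarrow> (\<exists>k. k + n \<le> N \<and> x = window u (i + k) n)"
proof
  assume "sublist x (window u i N)"
  then obtain ps ss where "window u i N = ps @ x @ ss"
    by (auto simp: sublist_def)
  from window_eq_append3D[OF this] assms show "\<exists>k. k + n \<le> N \<and> x = window u (i + k) n"
    by (auto intro!: exI[of _ "length ps"])
next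
  assume "\<exists>k. k + n \<le> N \<and> x = window u (i + k) n"
  then obtain k where k: "k + n \<le> N" "x = window u (i + k) n"
    by blast
  then have "x = take n (drop k (window u i N))"
    by (simp add: drop_window take_window)
  then show "sublist x (window u i N)"
    by (metis sublist_order.order_trans sublist_take sublist_drop)
qed

lemma factors_sublist: "\<lbrakk>y \<in> factors u; sublist x y\<rbrakk> \<Longrightarrow> x \<in> factors u"
  by (metis factors_iff sublist_window_iff window_in_factors)

subsection \<open>The recurrence function as a covering length\<close>

definition covers :: "'a word \<Rightarrow> nat \<Rightarrow> nat \<Rightarrow> bool" where
  "covers u n N \<longleftrightarrow> (\<forall>y\<in>factors_of_length u N. \<forall>x\<in>factors_of_length u n. sublist x y)"

lemma coversE:
  assumes "covers u n N" "x \<in> factors_of_length u n"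
  obtains k where "k + n \<le> N" "x = window u (i + k) n"
proof -
  have "length x = n"
    using assms(2) by (simp add: factors_of_length_def)
  moreover have "sublist x (window u i N)"
    using assms unfolding covers_def by (meson window_in_factors_of_length)
  ultimately show ?thesis
    using that sublist_window_iff by blast
qed

text \<open>Only finitely many prefixes of \<open>u\<close> have length at most \<open>i\<close>, so
  an infinite set of prefixes preceding \<open>x\<close> contains a longer one.\<close>

lemma recurrent_occurs_later:
  assumes "recurrent u" "x \<in> factors_of_length u n"
  shows "\<exists>j>i. x = window u j n"
proof -
  let ?P = "{p. \<exists>u'. u = p \<frown> x \<frown> u'}"
  have "x \<in> factors u" and n: "length x = n"
    using assms(2) by (auto simp: factors_of_length_def)
  then have "\<not> ?P \<subseteq> (\<lambda>k. window u 0 k) ` {..i}"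
    using assms(1) unfolding recurrent_def by (meson finite_atMost finite_imageI finite_subset)
  then obtain p u' where u: "u = p \<frown> x \<frown> u'" and p: "p \<notin> (\<lambda>k. window u 0 k) ` {..i}"
    by blast
  have "p = window u 0 (length p)"
    by (rule nth_equalityI) (auto simp: u nth_append)
  with p have "i < length p"
    by (metis atMost_iff imageI not_le)
  moreover have "x = window u (length p) n"
    by (rule nth_equalityI) (auto simp: u n nth_append)
  ultimately show ?thesis
    by blast
qed

text \<open>Any occurrence inside the complete return word starts between \<open>p\<close> and
  \<open>q\<close>, and only these endpoints remain possible; \<open>p < q\<close> keeps the two
  occurrences distinct.\<close>

lemma return_word_between_occurrences:
  assumes x: "x = window u p n" "x = window u q n" and "p < q"
    and between: "\<And>k. \<lbrakk>p < k; k < q\<rbrakk> \<Longrightarrow> x \<noteq> window u k n"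
  shows "window u p (q - p) \<in> return_words u x"
proof -
  let ?v = "window u p (q - p)" and ?c = "window u p (q - p + n)"
  have len: "length x = n"
    using x(1) by simp
  have vx: "?v @ x = ?c"
    using window_add[of u p "q - p" n] \<open>p < q\<close> x(2) by simp
  have xs: "?c = x @ window u (p + n) (q - p)"
    by (simp add: x(1) add.commute[of "q - p"] window_add)
  have "(a, b) \<in> {([], window u (p + n) (q - p)), (?v, [])}"
    if "(a, b) \<in> occurrences x ?c" for a b
  proof -
    from that have eq: "?c = a @ x @ b"
      by (simp add: occurrences_def)
    from window_eq_append3D[OF this] have "x = window u (p + length a) n" "q - p = length a + length b"
      using len by auto
    moreover from this have "p + length a < q" if "b \<noteq> []"
      using that \<open>p < q\<close> by (simp add: less_diff_conv2 flip: length_greater_0_conv)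
    ultimately have "a = [] \<or> b = []"
      using between[of "p + length a"] by fastforce
    then show ?thesis
      using eq xs vx by auto
  qed
  moreover have "{([], window u (p + n) (q - p)), (?v, [])} \<subseteq> occurrences x ?c"
    using xs vx by (auto simp: occurrences_def)
  ultimately have "occurrences x ?c = {([], window u (p + n) (q - p)), (?v, [])}"
    by auto
  moreover have "?v \<noteq> []"
    using \<open>p < q\<close> by simp
  ultimately have "card (occurrences x ?c) = 2"
    by (auto simp: card_2_iff)
  moreover have "Sublist.prefix x ?c"
    by (simp add: xs)
  ultimately show ?thesis
    by (simp add: return_words_def vx)
qed

text \<open>Deleting the first and last letters destroys both occurrences of \<open>x\<close>, so
  one that survives would be a third.\<close>

lemma not_sublist_return_word_interior:
  assumes "v \<in> return_words u x" "x \<noteq> []"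
  shows "v \<noteq> []" "\<not> sublist x (tl (butlast (v @ x)))"
proof -
  have pre: "Sublist.prefix x (v @ x)" and card: "card (occurrences x (v @ x)) = 2"
    using assms by (auto simp: return_words_def)
  show v: "v \<noteq> []"
  proof
    assume "v = []"
    then have "occurrences x (v @ x) = {([], [])}"
      by (auto simp: occurrences_def dest: arg_cong[where f = length])
    with card show False
      by simp
  qed
  obtain s where s: "v @ x = x @ s"
    using pre by (auto simp: Sublist.prefix_def)
  show "\<not> sublist x (tl (butlast (v @ x)))"
  proof
    assume "sublist x (tl (butlast (v @ x)))"
    then obtain a b where ab: "tl (butlast (v @ x)) = a @ x @ b"
      by (auto simp: sublist_def)
    obtain h v' where v': "v = h # v'"
      using v by (cases v) auto
    obtain x' l where x': "x = x' @ [l]"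
      using \<open>x \<noteq> []\<close> by (cases x rule: rev_cases) auto
    have "v' @ x' = a @ x @ b"
      using ab by (simp add: v' x' butlast_append)
    then have split: "v @ x = (h # a) @ x @ (b @ [l])"
      by (simp add: v' x')
    have "{([], s), (v, []), (h # a, b @ [l])} \<subseteq> occurrences x (v @ x)"
      using s split by (auto simp: occurrences_def)
    moreover have "finite (occurrences x (v @ x))"
      using card by (metis card.infinite zero_neq_numeral)
    ultimately have "card {([], s), (v, []), (h # a, b @ [l])} \<le> 2"
      using card by (metis card_mono)
    with v show False
      by simp
  qed
qed

text \<open>Let \<open>M\<close> be the length of a longest complete return word; then
  \<open>r\<close> is \<open>M - 1\<close>. The interior of that word has length
  \<open>M - 2\<close> and avoids the word returned to. A factor of length \<open>M - 1\<close>
  avoiding some \<open>x\<close> would lie inside a complete return word of \<open>x\<close> longer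
  than \<open>M\<close>.\<close>

lemma recurrence_function_covers:
  assumes fin: "finite (range u)" and ur: "uniformly_recurrent u" and "n > 0"
  obtains r where "recurrence_function u n = int r" "r \<ge> n" "covers u n r" "\<not> covers u n (r - 1)"
proof -
  define S where "S = {length (v @ w) |v w. w \<in> factors_of_length u n \<and> v \<in> return_words u w}"
  have rec: "recurrent u"
    using ur by (simp add: uniformly_recurrent_def)
  have "S = (\<lambda>(w, v). length (v @ w)) ` (SIGMA w:factors_of_length u n. return_words u w)"
    by (force simp: S_def)
  moreover have "finite (return_words u w)" if "w \<in> factors_of_length u n" for w
    using that ur by (auto simp: factors_of_length_def uniformly_recurrent_def)
  ultimately have "finite S"
    using finite_factors_of_length[OF fin] by simp
  have next_return: "\<exists>q>p. (\<forall>k. p < k \<and> k < q \<longrightarrow> x \<noteq> window u k n) \<and> x = window u q n \<and> q - p + n \<in> S"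
    if x: "x = window u p n" for x p
  proof -
    have mem: "x \<in> factors_of_length u n"
      using x by simp
    define q where "q = (LEAST q. p < q \<and> x = window u q n)"
    have q: "p < q \<and> x = window u q n"
      unfolding q_def using recurrent_occurs_later[OF rec mem] by (rule LeastI_ex)
    have between: "x \<noteq> window u k n" if "p < k" "k < q" for k
      using that not_less_Least[of k "\<lambda>q. p < q \<and> x = window u q n"] by (auto simp: q_def)
    have "window u p (q - p) \<in> return_words u x"
      using return_word_between_occurrences[OF x] q between by blast
    then have "length (window u p (q - p) @ x) \<in> S"
      using mem unfolding S_def by blast
    then have "q - p + n \<in> S"
      by (simp add: x)
    with q between show ?thesis
      by blast
  qed
  then have "S \<noteq> {}"
    by blast
  define M where "M = Max S"
  have "M \<in> S"
    using \<open>finite S\<close> \<open>S \<noteq> {}\<close> by (simp add: M_def)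
  then obtain v w where w: "w \<in> factors_of_length u n" and v: "v \<in> return_words u w"
    and M: "M = length v + n"
    by (auto simp: S_def factors_of_length_def)
  have "w \<noteq> []"
    using w \<open>n > 0\<close> by (auto simp: factors_of_length_def)
  note interior = not_sublist_return_word_interior[OF v this]
  have "M > n"
    using M interior(1) by simp
  show ?thesis
  proof (rule that[of "M - 1"])
    show "recurrence_function u n = int (M - 1)"
      using \<open>M > n\<close> unfolding recurrence_function_def S_def[symmetric] M_def[symmetric] by simp
    show "M - 1 \<ge> n"
      using \<open>M > n\<close> by simp
    have "v @ w \<in> factors u"
      using v by (simp add: return_words_def)
    then have "tl (butlast (v @ w)) \<in> factors u"
      by (rule factors_sublist) (metis sublist_butlast sublist_order.order_trans sublist_tl)
    then have "tl (butlast (v @ w)) \<in> factors_of_length u (M - 1 - 1)"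
      using w M by (simp add: factors_of_length_def)
    then show "\<not> covers u n (M - 1 - 1)"
      using w interior(2) unfolding covers_def by blast
    show "covers u n (M - 1)"
      unfolding covers_def
    proof (intro ballI, rule ccontr)
      fix y x
      assume y: "y \<in> factors_of_length u (M - 1)" and x: "x \<in> factors_of_length u n"
        and not: "\<not> sublist x y"
      have "length x = n"
        using x by (simp add: factors_of_length_def)
      obtain p0 where p0: "x = window u p0 n"
        using x by (auto simp: factors_of_length_iff)
      \<comment> \<open>Placing \<open>y\<close> after some occurrence of \<open>x\<close> ensures
        that a last occurrence of \<open>x\<close> up to \<open>i\<close> exists.\<close>
      obtain i where "i > p0" and i: "y = window u i (M - 1)"
        using recurrent_occurs_later[OF rec y] by blast
      have none: "x \<noteq> window u k n" if "i \<le> k" "k + n \<le> i + (M - 1)" for k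
        using not that sublist_window_iff[OF \<open>length x = n\<close>, of u i "M - 1"]
        by (auto simp: i dest!: spec[of _ "k - i"])
      define p where "p = (GREATEST k. k \<le> i \<and> x = window u k n)"
      have p: "p \<le> i \<and> x = window u p n"
        unfolding p_def
        by (rule GreatestI_nat[where P = "\<lambda>k. k \<le> i \<and> x = window u k n" and b = i and k = p0])
          (use p0 \<open>i > p0\<close> in simp_all)
      have p_max: "k \<le> p" if "k \<le> i" "x = window u k n" for k
        unfolding p_def
        by (rule Greatest_le_nat[where P = "\<lambda>k. k \<le> i \<and> x = window u k n" and b = i])
          (use that in simp_all)
      obtain q where q: "p < q" "x = window u q n" "q - p + n \<in> S"
        using next_return p by blast
      have "p < i"
        using p none[of i] \<open>M > n\<close> by (cases "p = i") auto
      \<comment> \<open>By maximality of \<open>p\<close> the later occurrence \<open>q\<close>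
        starts after \<open>i\<close>, so it must stick out of \<open>y\<close> on the
        right.\<close>
      have "q + n > i + (M - 1)"
        using none[of q] p_max[of q] q by linarith
      then have "q - p + n > M"
        using \<open>p < i\<close> \<open>p < q\<close> by linarith
      moreover have "q - p + n \<le> M"
        using q(3) \<open>finite S\<close> by (simp add: M_def)
      ultimately show False
        by simp
    qed
  qed
qed

lemma covers_imp_bound:
  assumes "covers u n N"
  shows "complexity u n \<le> N + 1 - n"
proof -
  have "factors_of_length u n \<subseteq> (\<lambda>k. window u k n) ` {..<N + 1 - n}"
  proof
    fix x assume "x \<in> factors_of_length u n"
    then obtain k where "k + n \<le> N" "x = window u (0 + k) n"
      using coversE[OF assms] by blast
    then show "x \<in> (\<lambda>k. window u k n) ` {..<N + 1 - n}"
      by auto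
  qed
  then show ?thesis
    unfolding complexity_def using surj_card_le[of "{..<N + 1 - n}"] by simp
qed

subsection \<open>Periodicity and complexity\<close>

lemma butlast_image_factors_of_length:
  "butlast ` factors_of_length u (Suc n) = factors_of_length u n"
  unfolding set_eq_iff image_iff
  by (force simp: factors_of_length_iff butlast_window)

text \<open>The Morse-Hedlund argument: without growth every factor of length \<open>n\<close> has a
  unique right extension. By pigeonhole some window repeats, at \<open>i\<close> and
  \<open>j\<close>, and from then on \<open>u\<close> has period \<open>j - i\<close>.\<close>

lemma aperiodic_complexity_less:
  assumes fin: "finite (range u)" and "aperiodic u"
  shows "complexity u n < complexity u (Suc n)"
proof (rule ccontr)
  let ?F = "factors_of_length u (Suc n)"
  note finF = finite_factors_of_length[OF fin]
  assume "\<not> ?thesis"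
  then have "card (butlast ` ?F) = card ?F"
    using card_image_le[OF finF, of butlast "Suc n"]
    by (simp add: complexity_def butlast_image_factors_of_length)
  then have inj: "inj_on butlast ?F"
    using finF by (simp add: eq_card_imp_inj_on)
  have "finite (range (\<lambda>i. window u i n))"
    using finF[of n] by (rule finite_subset[rotated]) auto
  then obtain i j where "i < j" and ij: "window u i n = window u j n"
    by (metis (no_types, lifting) finite_imageD infinite_UNIV_nat injI linorder_neqE_nat)
  have step: "window u (i + k) n = window u (j + k) n \<Longrightarrow> u (i + k + n) = u (j + k + n) \<and>
    window u (i + Suc k) n = window u (j + Suc k) n" for k
  proof -
    assume "window u (i + k) n = window u (j + k) n"
    then have "window u (i + k) (Suc n) = window u (j + k) (Suc n)"
      using inj by (auto simp: inj_on_def butlast_window)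
    from arg_cong[OF this, of "\<lambda>v. v ! n"] arg_cong[OF this, of "drop 1"]
    show "u (i + k + n) = u (j + k + n) \<and> window u (i + Suc k) n = window u (j + Suc k) n"
      by (simp add: drop_window)
  qed
  have win: "window u (i + k) n = window u (j + k) n" for k
    by (induction k) (use ij step in auto)
  define d where "d = j - i"
  have "d > 0"
    using \<open>i < j\<close> by (simp add: d_def)
  have per: "u (i + n + k + d) = u (i + n + k)" for k
    using win[of k] step[of k] \<open>i < j\<close> by (simp add: d_def algebra_simps)
  have "u (i + n + k) = u (i + n + k mod d)" for k
  proof (induction k rule: less_induct)
    case (less k)
    show ?case
    proof (cases "k < d")
      case False
      then obtain l where "k = l + d"
        by (metis le_add_diff_inverse2 not_less)
      then show ?thesis
        using less[of l] per[of l] \<open>d > 0\<close> by (simp add: add.assoc)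
    qed simp
  qed
  then have "u = window u 0 (i + n) \<frown> (window u (i + n) d)\<^sup>\<omega>"
    using \<open>d > 0\<close> by (intro ext) (auto simp: conc_def)
  moreover have "window u (i + n) d \<noteq> []"
    using \<open>d > 0\<close> by simp
  ultimately show False
    using \<open>aperiodic u\<close> unfolding aperiodic_def eventually_periodic_def by blast
qed

lemma complexity_0 [simp]: "complexity u 0 = 1"
proof -
  have "factors_of_length u 0 = {[]}"
    by (auto simp: factors_of_length_iff window_def)
  then show ?thesis
    by (simp add: complexity_def)
qed

lemma aperiodic_complexity_add:
  assumes "finite (range u)" "aperiodic u"
  shows "complexity u n + k \<le> complexity u (n + k)"
proof (induction k)
  case (Suc k)
  then show ?case
    using aperiodic_complexity_less[OF assms, of "n + k"] by simp
qed simp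

text \<open>Complexity starts at 1 and grows by at least one per step, so the bound at a single
  \<open>n\<close> forces equality at every smaller length.\<close>

lemma sturmian_if_infinitely_often:
  assumes "finite (range u)" "aperiodic u"
    and often: "\<And>N. \<exists>n>N. complexity u n \<le> n + 1"
  shows "sturmian u"
  unfolding sturmian_def
proof
  fix N
  obtain n where "n > N" "complexity u n \<le> n + 1"
    using often by blast
  then show "complexity u N = N + 1"
    using aperiodic_complexity_add[OF assms(1,2), of 0 N]
      aperiodic_complexity_add[OF assms(1,2), of N "n - N"] by simp
qed

subsection \<open>Powers and the index\<close>

text \<open>The exponent in \<open>is_power\<close> is dropped: for fixed \<open>w\<close> it is
  determined by the length of the power.\<close>

definition powers :: "'a word \<Rightarrow> 'a list \<Rightarrow> 'a list set" where
  "powers u w = {v \<in> factors u. length w \<le> length v \<and> (\<forall>k<length v. v ! k = w ! (k mod length w))}"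

lemma prefix_iter_iff:
  assumes "w \<noteq> []"
  shows "(\<exists>x. w\<^sup>\<omega> = v \<frown> x) \<longleftrightarrow> (\<forall>k<length v. v ! k = w ! (k mod length w))"
proof
  assume "\<exists>x. w\<^sup>\<omega> = v \<frown> x"
  then show "\<forall>k<length v. v ! k = w ! (k mod length w)"
    using assms by (metis conc_fst iter_nth length_greater_0_conv)
next
  assume v: "\<forall>k<length v. v ! k = w ! (k mod length w)"
  have "w\<^sup>\<omega> = v \<frown> (\<lambda>k. w\<^sup>\<omega> (length v + k))"
    using v assms by (intro ext) (simp add: conc_def)
  then show "\<exists>x. w\<^sup>\<omega> = v \<frown> x"
    by blast
qed

lemma ind_eq_SUP_powers:
  assumes "w \<noteq> []"
  shows "ind u w = (SUP v\<in>powers u w. ereal (real (length v) / real (length w)))"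
proof -
  have "is_power v w r \<and> v \<in> factors u \<longleftrightarrow> v \<in> powers u w \<and> r = of_nat (length v) / of_nat (length w)"
    for v r
    using assms by (auto simp: is_power_def prefix_iter_iff powers_def)
  then have "{ereal (of_rat r) |r. \<exists>v\<in>factors u. is_power v w r} =
    (\<lambda>v. ereal (of_rat (of_nat (length v) / of_nat (length w)))) ` powers u w"
    unfolding set_eq_iff mem_Collect_eq image_iff by metis
  also have "\<dots> = (\<lambda>v. ereal (real (length v) / real (length w))) ` powers u w"
    by (simp add: of_rat_divide)
  finally have "{ereal (of_rat r) |r. \<exists>v\<in>factors u. is_power v w r} =
    (\<lambda>v. ereal (real (length v) / real (length w))) ` powers u w" .
  then show ?thesis
    by (simp add: ind_def)
qed

text \<open>Lengths are integers, so a finite index is attained. The equation therefore says that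
  the longest powers of \<open>w\<close> have length \<open>r - 1\<close>.\<close>

lemma index_equation_iff:
  assumes "w \<noteq> []"
  shows "ereal (of_int (int r)) = ereal (real (length w)) * ind u w + 1 \<longleftrightarrow>
    (\<exists>v\<in>powers u w. length v + 1 = r) \<and> (\<forall>v\<in>powers u w. length v + 1 \<le> r)"
    (is "?eq \<longleftrightarrow> ?max")
proof -
  define n where "n = real (length w)"
  have "n > 0"
    using assms by (simp add: n_def)
  \<comment> \<open>An infinite index is impossible here: as \<open>n > 0\<close>, it would make the
    right-hand side infinite.\<close>
  have eq_iff: "?eq \<longleftrightarrow> ind u w = ereal ((real r - 1) / n)"
    using \<open>n > 0\<close> by (cases "ind u w") (auto simp: n_def[symmetric] field_simps one_ereal_def)
  have ind: "ind u w = (SUP v\<in>powers u w. ereal (real (length v) / n))"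
    using ind_eq_SUP_powers[OF assms] by (simp add: n_def)
  show ?thesis
  proof
    assume ?eq
    then have s: "ind u w = ereal ((real r - 1) / n)"
      using eq_iff by blast
    have bound: "length v + 1 \<le> r" if "v \<in> powers u w" for v
    proof -
      have "ereal (real (length v) / n) \<le> ind u w"
        unfolding ind using that by (rule SUP_upper)
      then have "real (length v) \<le> real r - 1"
        using \<open>n > 0\<close> by (simp add: s divide_le_cancel)
      then show ?thesis
        by linarith
    qed
    moreover have "\<exists>v\<in>powers u w. length v + 1 = r"
    proof (rule ccontr)
      assume "\<not> ?thesis"
      with bound have less: "length v + 2 \<le> r" if "v \<in> powers u w" for v
        using that by fastforce
      \<comment> \<open>Without a power of length \<open>r - 1\<close>, the supremum falls short by
        at least one whole letter.\<close>
      have "ind u w \<le> ereal ((real r - 2) / n)"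
        unfolding ind
      proof (rule SUP_least)
        fix v assume "v \<in> powers u w"
        from less[OF this] have "real (length v) \<le> real r - 2"
          by linarith
        then show "ereal (real (length v) / n) \<le> ereal ((real r - 2) / n)"
          using \<open>n > 0\<close> by (simp add: divide_right_mono)
      qed
      then show False
        using \<open>n > 0\<close> by (simp add: s divide_le_cancel)
    qed
    ultimately show ?max
      by blast
  next
    assume ?max
    then obtain v where v: "v \<in> powers u w" "length v + 1 = r"
      and bound: "\<And>v. v \<in> powers u w \<Longrightarrow> length v + 1 \<le> r"
      by blast
    have "ind u w = ereal ((real r - 1) / n)"
    proof (rule antisym)
      show "ind u w \<le> ereal ((real r - 1) / n)"
        unfolding ind
      proof (rule SUP_least)
        fix v assume "v \<in> powers u w"
        from bound[OF this] have "real (length v) \<le> real r - 1"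
          by linarith
        then show "ereal (real (length v) / n) \<le> ereal ((real r - 1) / n)"
          using \<open>n > 0\<close> by (simp add: divide_right_mono)
      qed
      have "real r - 1 = real (length v)"
        using v(2) by linarith
      then show "ereal ((real r - 1) / n) \<le> ind u w"
        unfolding ind using v(1) by (auto intro: SUP_upper)
    qed
    then show ?eq
      using eq_iff by blast
  qed
qed

text \<open>A window of the periodic word depends only on its start modulo \<open>n\<close>, which
  leaves the conjugates of \<open>w\<close>.\<close>

lemma factors_of_power:
  assumes "v \<in> powers u w" "length w = n" "n > 0"
  obtains i where "v = window u i (length v)"
    and "\<And>k. k + n \<le> length v \<Longrightarrow> window u (i + k) n \<in> (\<lambda>k. window w\<^sup>\<omega> k n) ` {..<n}"
proof -
  obtain i where i: "v = window u i (length v)"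
    using assms(1) by (auto simp: powers_def factors_iff)
  have letters: "u (i + k) = w ! (k mod n)" if "k < length v" for k
    using that assms i by (metis (mono_tags, lifting) mem_Collect_eq nth_window powers_def)
  show ?thesis
  proof (rule that[OF i])
    fix k assume "k + n \<le> length v"
    then have "window u (i + k) n = window w\<^sup>\<omega> (k mod n) n"
      using letters \<open>n > 0\<close> \<open>length w = n\<close>
      by (intro nth_equalityI) (simp_all add: add.assoc mod_add_left_eq)
    then show "window u (i + k) n \<in> (\<lambda>k. window w\<^sup>\<omega> k n) ` {..<n}"
      using \<open>n > 0\<close> by simp
  qed
qed

lemma complexity_le_if_covers_power:
  assumes "covers u n r" "v \<in> powers u w" "length w = n" "n > 0"
  shows "r \<le> length v \<Longrightarrow> complexity u n \<le> n"
    and "r \<le> length v + 1 \<Longrightarrow> complexity u n \<le> n + 1"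
proof -
  let ?A = "(\<lambda>k. window w\<^sup>\<omega> k n) ` {..<n}"
  obtain i where i: "\<And>k. k + n \<le> length v \<Longrightarrow> window u (i + k) n \<in> ?A"
    using factors_of_power[OF assms(2-4)] by blast
  have A: "card ?A \<le> n"
    by (metis card_image_le card_lessThan finite_lessThan)
  show "complexity u n \<le> n" if "r \<le> length v"
  proof -
    have "factors_of_length u n \<subseteq> ?A"
      using i that by (auto elim!: coversE[OF assms(1), of _ i])
    then show ?thesis
      unfolding complexity_def using A by (meson card_mono finite_imageI finite_lessThan le_trans)
  qed
  show "complexity u n \<le> n + 1" if "r \<le> length v + 1"
  proof -
    \<comment> \<open>Among the windows that fit into \<open>r\<close> letters, only the one
      starting at \<open>r - n\<close> can extend beyond \<open>v\<close>.\<close>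
    have "factors_of_length u n \<subseteq> insert (window u (i + (r - n)) n) ?A"
    proof
      fix x assume "x \<in> factors_of_length u n"
      then obtain k where k: "k + n \<le> r" "x = window u (i + k) n"
        by (rule coversE[OF assms(1)])
      then have "k + n \<le> length v \<or> k = r - n"
        using that by linarith
      then show "x \<in> insert (window u (i + (r - n)) n) ?A"
        using i k by blast
    qed
    then have "complexity u n \<le> card (insert (window u (i + (r - n)) n) ?A)"
      unfolding complexity_def by (intro card_mono) auto
    also have "\<dots> \<le> n + 1"
      by (rule card_insert_le_m1) (use A in simp_all)
    finally show ?thesis .
  qed
qed

subsection \<open>Jumps of the recurrence function\<close>

text \<open>Up to time \<open>e\<close> each value determines the next, so the sequence runs around
  a cycle whose length is the first return time \<open>j\<close>. One round visits each value
  exactly once, hence \<open>j = n\<close>.\<close>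

lemma deterministic_sequence_periodic:
  fixes g :: "nat \<Rightarrow> 'b"
  assumes det: "\<And>k l. \<lbrakk>k < e; l < e; g k = g l\<rbrakk> \<Longrightarrow> g (Suc k) = g (Suc l)"
    and return: "\<exists>k. 0 < k \<and> k \<le> e \<and> g k = g 0"
    and card: "card (g ` {..e}) = n" and "k + n \<le> e"
  shows "g (k + n) = g k"
proof -
  define j where "j = (LEAST j. 0 < j \<and> j \<le> e \<and> g j = g 0)"
  have j: "0 < j \<and> j \<le> e \<and> g j = g 0"
    unfolding j_def using return by (rule LeastI_ex)
  have j_least: "j \<le> l" if "0 < l" "l \<le> e" "g l = g 0" for l
    unfolding j_def using that by (intro Least_le) auto
  have propagate: "g (a + k) = g (b + k)" if "g a = g b" "a + k \<le> e" "b + k \<le> e" for a b k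
    using that by (induction k) (auto intro: det)
  have "g k \<in> g ` {..<j}" if "k \<le> e" for k
    using that
  proof (induction k rule: less_induct)
    case (less k)
    show ?case
    proof (cases "k < j")
      case False
      then have "g (j + (k - j)) = g (0 + (k - j))"
        using j less.prems by (intro propagate) auto
      then show ?thesis
        using less.IH[of "k - j"] less.prems j False by simp
    qed simp
  qed
  then have "g ` {..e} = g ` {..<j}"
    using j by auto
  moreover have "inj_on g {..<j}"
  proof (rule linorder_inj_onI)
    fix a b assume "a < b" "a \<in> {..<j}" "b \<in> {..<j}"
    show "g a \<noteq> g b"
    proof
      assume "g a = g b"
      \<comment> \<open>A repetition within one round, followed up to time \<open>j\<close>, would
        yield a return to \<open>g 0\<close> earlier than \<open>j\<close>.\<close>
      then have "g (a + (j - b)) = g (b + (j - b))"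
        using \<open>a < b\<close> \<open>b \<in> {..<j}\<close> j by (intro propagate) auto
      then have "g (a + (j - b)) = g 0"
        using \<open>b \<in> {..<j}\<close> j by simp
      then have "j \<le> a + (j - b)"
        using \<open>a < b\<close> \<open>b \<in> {..<j}\<close> j by (intro j_least) auto
      then show False
        using \<open>a < b\<close> \<open>b \<in> {..<j}\<close> by auto
    qed
  qed auto
  ultimately have "j = n"
    using card by (simp add: card_image)
  then show ?thesis
    using propagate[of j 0 k] j \<open>k + n \<le> e\<close> by (simp add: add.commute)
qed

lemma periodic_factor_at_jump:
  assumes fin: "finite (range u)"
    and c: "complexity u m = m + 1" "complexity u (Suc m) = m + 2"
    and cov: "covers u m r'" and ncov: "\<not> covers u (Suc m) (r - 1)"
    and jump: "r' + 2 \<le> r" and "m > 0"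
  obtains i where "\<And>k. k + Suc m < r - 1 \<Longrightarrow> u (i + k + Suc m) = u (i + k)"
proof -
  let ?F = "factors_of_length u"
  obtain x z where x: "x \<in> ?F (Suc m)" and z: "z \<in> ?F (r - 1)" and not: "\<not> sublist x z"
    using ncov by (auto simp: covers_def)
  have lx: "length x = Suc m"
    using x by (simp add: factors_of_length_def)
  obtain i where i: "z = window u i (r - 1)"
    using z by (auto simp: factors_of_length_iff)
  have avoid: "window u (i + k) (Suc m) \<noteq> x" if "k + Suc m \<le> r - 1" for k
    using not that sublist_window_iff[OF lx] by (metis i)
  \<comment> \<open>The windows of length \<open>m\<close> in \<open>z\<close> start at offsets 0 to
    \<open>e\<close>; \<open>g\<close> lists them as a path in the Rauzy graph.\<close>
  define e where "e = r - 1 - m"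
  have "2 * m \<le> r'"
    using covers_imp_bound[OF cov] c(1) by simp
  with jump have e: "Suc m \<le> e" "r - 1 = e + m" "r' + 1 \<le> e + m"
    by (auto simp: e_def)
  define g where "g k = window u (i + k) m" for k
  \<comment> \<open>Dropping the last letter of \<open>z\<close> gives an occurrence with
    \<open>k < e\<close>, which therefore has a continuation inside \<open>z\<close>.\<close>
  have initial: "\<exists>k<e. g k = y" if y: "y \<in> ?F m" for y
  proof (rule coversE[OF cov y, of i])
    fix k assume "k + m \<le> r'" "y = window u (i + k) m"
    then show ?thesis
      using e by (intro exI[of _ k]) (auto simp: g_def)
  qed
  \<comment> \<open>Dropping the first letter instead gives an occurrence with \<open>0 < k\<close>;
    applied to \<open>g 0\<close>, this closes the cycle.\<close>
  have final: "\<exists>k. 0 < k \<and> k \<le> e \<and> g k = y" if y: "y \<in> ?F m" for y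
  proof (rule coversE[OF cov y, of "i + 1"])
    fix k assume "k + m \<le> r'" "y = window u (i + 1 + k) m"
    then show ?thesis
      using e by (intro exI[of _ "Suc k"]) (auto simp: g_def)
  qed
  have "g ` {..e} = ?F m"
    using initial by (force simp: g_def)
  then have card_g: "card (g ` {..e}) = Suc m"
    using c(1) by (simp add: complexity_def)
  have bl: "butlast ` (?F (Suc m) - {x}) = ?F m"
  proof
    show "butlast ` (?F (Suc m) - {x}) \<subseteq> ?F m"
      using butlast_image_factors_of_length by blast
    show "?F m \<subseteq> butlast ` (?F (Suc m) - {x})"
    proof
      fix y assume "y \<in> ?F m"
      then obtain k where "k < e" "g k = y"
        using initial by blast
      then show "y \<in> butlast ` (?F (Suc m) - {x})"
        using avoid[of k] e
        by (intro image_eqI[of _ _ "window u (i + k) (Suc m)"]) (auto simp: g_def butlast_window)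
    qed
  qed
  \<comment> \<open>Without \<open>x\<close> there remain \<open>m + 1\<close> words over
    \<open>m + 1\<close> prefixes, so the continuation of each prefix is unique.\<close>
  have inj: "inj_on butlast (?F (Suc m) - {x})"
    using c x finite_factors_of_length[OF fin]
    by (intro eq_card_imp_inj_on) (auto simp: bl complexity_def card_Diff_singleton)
  have det: "g (Suc k) = g (Suc l)" if "k < e" "l < e" "g k = g l" for k l
  proof -
    have "window u (i + k) (Suc m) = window u (i + l) (Suc m)"
    proof (rule inj_onD[OF inj])
      show "butlast (window u (i + k) (Suc m)) = butlast (window u (i + l) (Suc m))"
        using that(3) by (simp add: butlast_window g_def)
      show "window u (i + k) (Suc m) \<in> ?F (Suc m) - {x}"
        using avoid[of k] that(1) e by simp
      show "window u (i + l) (Suc m) \<in> ?F (Suc m) - {x}"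
        using avoid[of l] that(2) e by simp
    qed
    from arg_cong[OF this, of "drop 1"] show ?thesis
      by (simp add: drop_window g_def)
  qed
  have "\<exists>k. 0 < k \<and> k \<le> e \<and> g k = g 0"
    by (rule final) (simp add: g_def)
  then have per: "g (k + Suc m) = g k" if "k + Suc m \<le> e" for k
    using det card_g that by (intro deterministic_sequence_periodic[of e g])
  show ?thesis
  proof (rule that[of i])
    fix k assume k: "k + Suc m < r - 1"
    \<comment> \<open>Letter \<open>k\<close> is read from a window whose start is capped at
      \<open>e - Suc m\<close>, the last offset to which \<open>per\<close> applies.\<close>
    define a where "a = min k (e - Suc m)"
    have a: "a \<le> k" "k - a < m" "a + Suc m \<le> e"
      using k e \<open>m > 0\<close> by (auto simp: a_def)
    have "g (a + Suc m) ! (k - a) = g a ! (k - a)"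
      using per[OF a(3)] by simp
    moreover have "i + (a + Suc m) + (k - a) = i + k + Suc m" "i + a + (k - a) = i + k"
      using a(1) by simp_all
    ultimately show "u (i + k + Suc m) = u (i + k)"
      using a(2) unfolding g_def by (metis nth_window)
  qed
qed

lemma periodic_window_in_powers:
  assumes "\<And>k. k + n < N \<Longrightarrow> u (i + k + n) = u (i + k)" "0 < n" "n \<le> N"
  shows "window u i N \<in> powers u (window u i n)"
proof -
  have "u (i + k) = u (i + k mod n)" if "k < N" for k
    using that
  proof (induction k rule: less_induct)
    case (less k)
    show ?case
    proof (cases "k < n")
      case False
      then obtain l where "k = l + n"
        by (metis le_add_diff_inverse2 not_less)
      then show ?thesis
        using less.IH[of l] less.prems assms(1)[of l] \<open>0 < n\<close> by (simp add: add.assoc)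
    qed simp
  qed
  then show ?thesis
    using assms by (simp add: powers_def)
qed

text \<open>Over a finite alphabet each length admits finitely many factors, so an infinite set of
  factors has unbounded lengths.\<close>

lemma infinite_factors_iff:
  assumes "finite (range u)"
  shows "infinite {w \<in> factors u. P w} \<longleftrightarrow> (\<forall>N. \<exists>w\<in>factors u. N < length w \<and> P w)"
proof -
  have "finite {w \<in> factors u. P w} \<longleftrightarrow> (\<exists>N. \<forall>w\<in>{w \<in> factors u. P w}. length w \<le> N)"
  proof
    assume "finite {w \<in> factors u. P w}"
    then have "finite (length ` {w \<in> factors u. P w})"
      by simp
    then show "\<exists>N. \<forall>w\<in>{w \<in> factors u. P w}. length w \<le> N"
      unfolding finite_nat_set_iff_bounded_le by auto
  next
    assume "\<exists>N. \<forall>w\<in>{w \<in> factors u. P w}. length w \<le> N"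
    then obtain N where "\<forall>w\<in>{w \<in> factors u. P w}. length w \<le> N" ..
    then have "{w \<in> factors u. P w} \<subseteq> (\<Union>n\<in>{..N}. factors_of_length u n)"
      by (auto simp: factors_of_length_def)
    moreover have "finite (\<Union>n\<in>{..N}. factors_of_length u n)"
      using finite_factors_of_length[OF assms] by simp
    ultimately show "finite {w \<in> factors u. P w}"
      by (rule finite_subset)
  qed
  then show ?thesis
    by (simp add: not_le) blast
qed

theorem theorem1:
  fixes u :: "'a word"
  assumes "finite (range u)"
    and "uniformly_recurrent u"
    and "aperiodic u"
  shows "sturmian u \<longleftrightarrow>
    infinite {w \<in> factors u.
      ereal (of_int (recurrence_function u (length w))) = ereal (real (length w)) * ind u w + 1}"
proof -
  let ?P = "\<lambda>w. ereal (of_int (recurrence_function u (length w))) = ereal (real (length w)) * ind u w + 1"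
  define R where "R n = nat (recurrence_function u n)" for n
  have R: "recurrence_function u n = int (R n) \<and> n \<le> R n \<and> covers u n (R n) \<and> \<not> covers u n (R n - 1)"
    if "n > 0" for n
    by (rule recurrence_function_covers[OF assms(1,2) that]) (simp add: R_def)
  have P_iff: "?P w \<longleftrightarrow> (\<exists>v\<in>powers u w. length v + 1 = R (length w)) \<and>
    (\<forall>v\<in>powers u w. length v + 1 \<le> R (length w))" if "w \<noteq> []" for w
    using index_equation_iff[OF that, of "R (length w)" u] R[of "length w"] that by simp
  have "\<exists>w\<in>factors u. N < length w \<and> ?P w" if "sturmian u" for N
  proof -
    have c: "complexity u n = n + 1" for n
      using that by (simp add: sturmian_def)
    have double: "2 * n \<le> R n" if "n > 0" for n
      using covers_imp_bound[of u n "R n"] R[OF that] c[of n] by simp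
    have "\<exists>m>N. R m + 2 \<le> R (Suc m)"
    proof (rule ccontr)
      assume "\<not> ?thesis"
      then have step: "R (Suc m) \<le> R m + 1" if "m > N" for m
        using that by (metis add_2_eq_Suc' add.commute not_less_eq_eq plus_1_eq_Suc)
      have slow: "R (Suc N + k) \<le> R (Suc N) + k" for k
      proof (induction k)
        case (Suc k)
        then show ?case
          using step[of "Suc N + k"] by simp
      qed simp
      \<comment> \<open>At this length slow growth gives at most \<open>2 * R (Suc N)\<close>, which
        is below the required \<open>2 * ?n\<close>.\<close>
      let ?n = "Suc N + R (Suc N)"
      show False
        using slow[of "R (Suc N)"] double[of ?n] by simp
    qed
    then obtain m where m: "m > N" "R m + 2 \<le> R (Suc m)"
      by blast
    then have "m > 0"
      by simp
    obtain i where per: "\<And>k. k + Suc m < R (Suc m) - 1 \<Longrightarrow> u (i + k + Suc m) = u (i + k)"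
      using periodic_factor_at_jump[OF assms(1), of m "R m" "R (Suc m)"] R[of m] R[of "Suc m"] c m \<open>m > 0\<close>
      by auto
    define w where "w = window u i (Suc m)"
    have w: "w \<noteq> []" "length w = Suc m"
      by (simp_all add: w_def)
    have "Suc m \<le> R (Suc m) - 1"
      using double[of "Suc m"] by simp
    with per have "window u i (R (Suc m) - 1) \<in> powers u w"
      unfolding w_def by (intro periodic_window_in_powers) auto
    \<comment> \<open>A power of length \<open>R (Suc m)\<close> or more would contain all
      \<open>m + 2\<close> factors of length \<open>Suc m\<close>, but it has room for only
      \<open>m + 1\<close>.\<close>
    moreover have "length v + 1 \<le> R (Suc m)" if "v \<in> powers u w" for v
      using complexity_le_if_covers_power(1)[OF _ that w(2)] R[of "Suc m"] c[of "Suc m"] by fastforce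
    moreover have "length (window u i (R (Suc m) - 1)) + 1 = R (Suc m)"
      using m by simp
    ultimately have "?P w"
      using P_iff[OF w(1)] unfolding w(2) by blast
    then show ?thesis
      using m w by (intro bexI[of _ w]) (auto simp: w_def)
  qed
  \<comment> \<open>Aperiodicity enters here, through the strict growth of complexity.\<close>
  moreover have "sturmian u" if inf: "\<forall>N. \<exists>w\<in>factors u. N < length w \<and> ?P w"
  proof (rule sturmian_if_infinitely_often[OF assms(1,3)])
    fix N
    obtain w where w: "N < length w" "?P w"
      using inf by blast
    then have "w \<noteq> []"
      by auto
    with w P_iff obtain v where "v \<in> powers u w" "length v + 1 = R (length w)"
      by blast
    then have "complexity u (length w) \<le> length w + 1"
      using R[of "length w"] \<open>w \<noteq> []\<close> by (intro complexity_le_if_covers_power(2)) auto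
    with w show "\<exists>n>N. complexity u n \<le> n + 1"
      by blast
  qed
  ultimately show ?thesis
    unfolding infinite_factors_iff[OF assms(1)] by blast
qed

end
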